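(* Let $(\Omega,\mathcal F,\mathbb P)$ be a standard nonatomic probability space and $\theta:\Omega\to\Omega$ an aperiodic ergodic invertible, bimeasurable, measure-preserving transformation. Let $(X,d)$ be Polish, $Y$ a Banach space, $1\le p<\infty$, and let $G_\omega:X\times X\to Y$ ($\omega\in\Omega$) be a measurable family with one-step residual $(G\Gamma)(\omega)=G_\omega(\Gamma(\omega),\Gamma(\theta\omega))$. Let $\xi_0,\xi_1\in L^p(\Omega;X)$ satisfy $G_\omega(\xi_i(\omega),\xi_i(\theta\omega))=0$ a.e. for $i=0,1$ and $d(\xi_0(\omega),\xi_1(\omega))>0$ a.e. Put $q(\omega)=\max_{i\ne j}\|G_\omega(\xi_i(\omega),\xi_j(\theta\omega))\|_Y$ and $r(\omega)=\min_{i\ne j}\|G_\omega(\xi_i(\omega),\xi_j(\theta\omega))\|_Y$ ($i,j\in\{0,1\}$), and assume $q\in L^p(\Omega)$ and $r>0$ a.e. For measurable $A\subset\Omega$ let $\Gamma_A=\xi_1$ on $A$ and $\Gamma_A=\xi_0$ on $A^c$. Then there is a sequence of measurable sets $A_n\subset\Omega$ such that $\|G(\Gamma_{A_n})\|_{L^p}\to0$ and $(\Gamma_{A_n})_n$ has no strongly convergent subsequence in $L^p(\Omega;X)$.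
   Context: $L^p(\Omega;X)$ is the set of a.e.-classes of strongly measurable $u:\Omega\to X$ with $\int_\Omega d(u,x_\circ)^p\,d\mathbb P<\infty$ for a fixed $x_\circ\in X$, with metric $D_p(u,v)=\bigl(\int_\Omega d(u,v)^p\,d\mathbb P\bigr)^{1/p}$; strong convergence means convergence in $D_p$. A measurable family $G_\omega$ means that $(\omega,x,y)\mapsto G_\omega(x,y)$ is measurable. $\|G(\Gamma)\|_{L^p}^p=\int_\Omega\|G_\omega(\Gamma(\omega),\Gamma(\theta\omega))\|_Y^p\,d\mathbb P$. $\theta$ is aperiodic if $\mathbb P\{\omega:\theta^q\omega=\omega\}=0$ for every integer $q\ne0$. *)

theory Defs
  imports "HOL-Probability.Probability"
begin

section \<open>Standard nonatomic probability spaces\<close>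

definition standard_borel :: "'a measure \<Rightarrow> bool" where
  "standard_borel M \<longleftrightarrow>
     (\<exists>T. topspace T = space M \<and> completely_metrizable_space T \<and> second_countable T \<and>
          sets M = sigma_sets (space M) {U. openin T U})"

text \<open>Both usual conventions are admitted: a Borel probability measure on a standard Borel
  space, or the completion of one.\<close>

definition standard_prob_space :: "'a measure \<Rightarrow> bool" where
  "standard_prob_space M \<longleftrightarrow>
     prob_space M \<and> (\<exists>B. standard_borel B \<and> (M = B \<or> M = completion B))"

definition nonatomic :: "'a measure \<Rightarrow> bool" where
  "nonatomic M \<longleftrightarrow>
     (\<forall>A\<in>sets M. 0 < emeasure M A \<longrightarrow>
        (\<exists>B\<in>sets M. B \<subseteq> A \<and> 0 < emeasure M B \<and> emeasure M B < emeasure M A))"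

section \<open>Aperiodic ergodic automorphisms\<close>

definition invertible_mpt :: "'a measure \<Rightarrow> ('a \<Rightarrow> 'a) \<Rightarrow> bool" where
  "invertible_mpt M \<theta> \<longleftrightarrow>
     bij_betw \<theta> (space M) (space M) \<and>
     \<theta> \<in> measurable M M \<and> the_inv_into (space M) \<theta> \<in> measurable M M \<and>
     (\<forall>A\<in>sets M. emeasure M (\<theta> -` A \<inter> space M) = emeasure M A)"

definition ergodic :: "'a measure \<Rightarrow> ('a \<Rightarrow> 'a) \<Rightarrow> bool" where
  "ergodic M \<theta> \<longleftrightarrow>
     (\<forall>A\<in>sets M. \<theta> -` A \<inter> space M = A \<longrightarrow> emeasure M A = 0 \<or> emeasure M A = 1)"

definition int_iterate :: "'a measure \<Rightarrow> ('a \<Rightarrow> 'a) \<Rightarrow> int \<Rightarrow> 'a \<Rightarrow> 'a" where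
  "int_iterate M \<theta> q =
     (if 0 \<le> q then \<theta> ^^ nat q else the_inv_into (space M) \<theta> ^^ nat (- q))"

text \<open>Membership in \<open>null_sets\<close> includes measurability, so a nonmeasurable set of periodic
  points is not silently given measure zero.\<close>

definition aperiodic :: "'a measure \<Rightarrow> ('a \<Rightarrow> 'a) \<Rightarrow> bool" where
  "aperiodic M \<theta> \<longleftrightarrow>
     (\<forall>q::int. q \<noteq> 0 \<longrightarrow> {\<omega>\<in>space M. int_iterate M \<theta> q \<omega> = \<omega>} \<in> null_sets M)"

section \<open>Lebesgue spaces of maps into a metric space\<close>

definition strongly_measurable :: "'a measure \<Rightarrow> ('a \<Rightarrow> 'x::metric_space) \<Rightarrow> bool" where
  "strongly_measurable M u \<longleftrightarrow>
     (\<exists>s. (\<forall>n::nat. simple_function M (s n)) \<and>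
          (\<forall>\<omega>\<in>space M. (\<lambda>n. s n \<omega>) \<longlonglongrightarrow> u \<omega>))"

text \<open>The \<open>L\<^sup>p\<close> norm takes values in \<open>[0, \<infinity>]\<close>: a function whose \<open>p\<close>-th power is not
  integrable has norm \<open>\<infinity>\<close>, not \<open>0\<close>.\<close>

definition Lp_norm :: "'a measure \<Rightarrow> real \<Rightarrow> ('a \<Rightarrow> 'b::real_normed_vector) \<Rightarrow> ennreal" where
  "Lp_norm M p f =
     (let I = (\<integral>\<^sup>+\<omega>. ennreal (norm (f \<omega>) powr p) \<partial>M)
      in if I = \<infinity> then \<infinity> else ennreal (enn2real I powr (1 / p)))"

text \<open>The elements of \<open>Lp_space M p x\<^sub>0\<close> represent the a.e.-classes forming \<open>L\<^sup>p(\<Omega>;X)\<close>;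
  \<open>Lp_dist\<close> depends on the classes only.\<close>

definition Lp_space :: "'a measure \<Rightarrow> real \<Rightarrow> 'x::metric_space \<Rightarrow> ('a \<Rightarrow> 'x) set" where
  "Lp_space M p x\<^sub>0 =
     {u. strongly_measurable M u \<and> (\<integral>\<^sup>+\<omega>. ennreal (dist (u \<omega>) x\<^sub>0 powr p) \<partial>M) < \<infinity>}"

definition Lp_dist ::
  "'a measure \<Rightarrow> real \<Rightarrow> ('a \<Rightarrow> 'x::metric_space) \<Rightarrow> ('a \<Rightarrow> 'x) \<Rightarrow> ennreal" where
  "Lp_dist M p u v = Lp_norm M p (\<lambda>\<omega>. dist (u \<omega>) (v \<omega>))"

definition Lp_converges ::
  "'a measure \<Rightarrow> real \<Rightarrow> 'x::metric_space \<Rightarrow> (nat \<Rightarrow> 'a \<Rightarrow> 'x) \<Rightarrow> bool" where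
  "Lp_converges M p x\<^sub>0 u \<longleftrightarrow>
     (\<exists>v\<in>Lp_space M p x\<^sub>0. (\<lambda>n. Lp_dist M p (u n) v) \<longlonglongrightarrow> 0)"

section \<open>One-step residuals and switched selections\<close>

definition measurable_family ::
  "'a measure \<Rightarrow> ('a \<Rightarrow> 'x::polish_space \<Rightarrow> 'x \<Rightarrow> 'y::banach) \<Rightarrow> bool" where
  "measurable_family M G \<longleftrightarrow>
     (\<lambda>(\<omega>, x, y). G \<omega> x y) \<in> borel_measurable (M \<Otimes>\<^sub>M (borel \<Otimes>\<^sub>M borel))"

definition residual ::
  "('a \<Rightarrow> 'a) \<Rightarrow> ('a \<Rightarrow> 'x \<Rightarrow> 'x \<Rightarrow> 'y) \<Rightarrow> ('a \<Rightarrow> 'x) \<Rightarrow> 'a \<Rightarrow> 'y" where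
  "residual \<theta> G \<Gamma> \<omega> = G \<omega> (\<Gamma> \<omega>) (\<Gamma> (\<theta> \<omega>))"

definition cross_values ::
  "('a \<Rightarrow> 'a) \<Rightarrow> ('a \<Rightarrow> 'x \<Rightarrow> 'x \<Rightarrow> 'y::real_normed_vector) \<Rightarrow> (nat \<Rightarrow> 'a \<Rightarrow> 'x) \<Rightarrow> 'a \<Rightarrow> real set"
  where
  "cross_values \<theta> G \<xi> \<omega> =
     {norm (G \<omega> (\<xi> i \<omega>) (\<xi> j (\<theta> \<omega>))) | i j. i \<in> {0, 1} \<and> j \<in> {0, 1} \<and> i \<noteq> j}"

definition switched :: "(nat \<Rightarrow> 'a \<Rightarrow> 'x) \<Rightarrow> 'a set \<Rightarrow> 'a \<Rightarrow> 'x" where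
  "switched \<xi> A \<omega> = (if \<omega> \<in> A then \<xi> 1 \<omega> else \<xi> 0 \<omega>)"

lemma cross_values_eq:
  "cross_values \<theta> G \<xi> \<omega> =
     {norm (G \<omega> (\<xi> 0 \<omega>) (\<xi> 1 (\<theta> \<omega>))), norm (G \<omega> (\<xi> 1 \<omega>) (\<xi> 0 (\<theta> \<omega>)))}"
  by (auto simp: cross_values_def)

lemma strongly_measurable_borel:
  assumes "strongly_measurable M u"
  shows "u \<in> borel_measurable M"
proof -
  obtain s where s: "\<And>n::nat. simple_function M (s n)"
    and lim: "\<And>\<omega>. \<omega> \<in> space M \<Longrightarrow> (\<lambda>n. s n \<omega>) \<longlonglongrightarrow> u \<omega>"
    using assms by (auto simp: strongly_measurable_def)
  show ?thesis
    by (rule borel_measurable_LIMSEQ_metric[OF borel_measurable_simple_function[OF s] lim])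
qed

lemma switched_in_Lp_space:
  assumes "\<xi> 0 \<in> Lp_space M p x\<^sub>0" "\<xi> 1 \<in> Lp_space M p x\<^sub>0" "A \<in> sets M"
  shows "switched \<xi> A \<in> Lp_space M p x\<^sub>0"
proof -
  obtain s where s: "\<And>n::nat. simple_function M (s n)"
    and slim: "\<And>\<omega>. \<omega> \<in> space M \<Longrightarrow> (\<lambda>n. s n \<omega>) \<longlonglongrightarrow> \<xi> 0 \<omega>"
    using assms(1) by (auto simp: Lp_space_def strongly_measurable_def)
  obtain t where t: "\<And>n::nat. simple_function M (t n)"
    and tlim: "\<And>\<omega>. \<omega> \<in> space M \<Longrightarrow> (\<lambda>n. t n \<omega>) \<longlonglongrightarrow> \<xi> 1 \<omega>"
    using assms(2) by (auto simp: Lp_space_def strongly_measurable_def)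
  have 1: "strongly_measurable M (switched \<xi> A)"
    unfolding strongly_measurable_def
  proof (intro exI conjI allI ballI)
    show "simple_function M (\<lambda>\<omega>. if \<omega> \<in> A then t n \<omega> else s n \<omega>)" for n
      using simple_function_If_set[OF t s, of A n n] assms(3) by (simp add: sets.sets_into_space Int_absorb2)
    show "(\<lambda>n. if \<omega> \<in> A then t n \<omega> else s n \<omega>) \<longlonglongrightarrow> switched \<xi> A \<omega>" if "\<omega> \<in> space M" for \<omega>
      using slim[OF that] tlim[OF that] by (auto simp: switched_def)
  qed
  have m: "\<xi> 0 \<in> borel_measurable M" "\<xi> 1 \<in> borel_measurable M"
    using assms by (auto simp: Lp_space_def intro: strongly_measurable_borel)
  have m': "(\<lambda>\<omega>. dist (\<xi> i \<omega>) x\<^sub>0) \<in> borel_measurable M" if "\<xi> i \<in> borel_measurable M" for i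
    by (rule measurable_compose[OF that]) (intro borel_measurable_continuous_onI continuous_intros)
  have "(\<integral>\<^sup>+\<omega>. ennreal (dist (switched \<xi> A \<omega>) x\<^sub>0 powr p) \<partial>M)
      \<le> (\<integral>\<^sup>+\<omega>. ennreal (dist (\<xi> 0 \<omega>) x\<^sub>0 powr p) + ennreal (dist (\<xi> 1 \<omega>) x\<^sub>0 powr p) \<partial>M)"
    by (rule nn_integral_mono) (auto simp: switched_def)
  also have "\<dots> = (\<integral>\<^sup>+\<omega>. ennreal (dist (\<xi> 0 \<omega>) x\<^sub>0 powr p) \<partial>M)
      + (\<integral>\<^sup>+\<omega>. ennreal (dist (\<xi> 1 \<omega>) x\<^sub>0 powr p) \<partial>M)"
    by (rule nn_integral_add) (use m'[OF m(1)] m'[OF m(2)] in measurable)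
  also have "\<dots> < \<infinity>"
    using assms by (simp add: Lp_space_def)
  finally show ?thesis using 1 by (simp add: Lp_space_def)
qed

end

theory Submission
  imports Defs
begin

text \<open>
  For a measurable set \<open>A\<close> let \<open>S\<close> be the set of those \<open>\<omega>\<close> for which exactly one of \<open>\<omega>\<close> and
  \<open>\<theta> \<omega>\<close> lies in \<open>A\<close>. Off \<open>S\<close> the switched selection follows one of the two exact solutions
  for a step, so its residual vanishes a.e.; on \<open>S\<close> the residual is bounded by the larger cross
  value, whose \<open>p\<close>-th power is integrable. It therefore suffices to find sets \<open>A\<^sub>n\<close> that are
  almost invariant, \<open>P(S\<^sub>n) \<rightarrow> 0\<close>, while \<open>P(A\<^sub>n)\<close> stays away from \<open>0\<close> and \<open>1\<close>.

  Such sets come from hitting times. Fix \<open>B\<close> with \<open>P(B) > 0\<close> small and let \<open>A\<close> be the set of points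
  that visit \<open>B\<close> within \<open>k\<close> steps. A point can leave \<open>A\<close> only through \<open>B\<close>, and a point that
  enters \<open>A\<close> in one step hits \<open>B\<close> at the exact time \<open>k + 1\<close>, which again has probability at
  most \<open>P(B)\<close>; so \<open>A\<close> is invariant up to \<open>2 P(B)\<close>, whatever \<open>k\<close> is. As \<open>k\<close> grows, the
  probability of \<open>A\<close> increases to \<open>1\<close> by ergodicity, in steps of size at most \<open>P(B)\<close>, hence it
  takes a value in \<open>[1/2, 3/4]\<close> on the way (\<open>almost_invariant_half_set\<close>).

  If a subsequence of the switched selections converged in \<open>L\<^sup>p\<close>, then a further subsequence would
  converge a.e. Because the two solutions differ a.e., the corresponding indicator functions would
  be eventually constant a.e., and their limit set would be invariant modulo null sets but of
  probability between \<open>1/2\<close> and \<open>3/4\<close>. This contradicts ergodicity (\<open>ergodic_AE_invariant\<close>).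
\<close>

section \<open>Almost invariant sets of intermediate probability\<close>

text \<open>One of the two pieces of a nontrivial splitting carries at most half of the mass, so
  splitting repeatedly drives the mass to zero.\<close>

lemma nonatomic_small_set:
  assumes "prob_space M" "nonatomic M" "0 < e"
  obtains B where "B \<in> sets M" "0 < measure M B" "measure M B < e"
proof -
  interpret prob_space M by fact
  have "\<exists>B\<in>sets M. 0 < measure M B \<and> measure M B \<le> (1/2) ^ n" for n
  proof (induction n)
    case 0
    show ?case by (rule bexI[of _ "space M"]) (auto simp: prob_space)
  next
    case (Suc n)
    then obtain A where A: "A \<in> sets M" "0 < measure M A" "measure M A \<le> (1/2) ^ n" by blast
    then obtain B where B: "B \<in> sets M" "B \<subseteq> A" "0 < measure M B" "measure M B < measure M A"
      using \<open>nonatomic M\<close> by (auto simp: nonatomic_def emeasure_eq_measure ennreal_less_iff)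
    have D: "measure M (A - B) = measure M A - measure M B"
      using A B by (intro finite_measure_Diff)
    show ?case
    proof (cases "measure M B \<le> measure M A / 2")
      case True
      then show ?thesis using A B by (intro bexI[of _ B]) auto
    next
      case False
      then show ?thesis using A B D by (intro bexI[of _ "A - B"]) auto
    qed
  qed
  moreover obtain n where "(1/2) ^ n < e"
    using real_arch_pow_inv[of e "1/2"] \<open>0 < e\<close> by auto
  ultimately show ?thesis using that by (meson order_le_less_trans)
qed

lemma invertible_mpt_measurable: "invertible_mpt M \<theta> \<Longrightarrow> \<theta> \<in> measurable M M"
  by (simp add: invertible_mpt_def)

lemma invertible_mpt_measure:
  assumes "invertible_mpt M \<theta>" "A \<in> sets M"
  shows "measure M (\<theta> -` A \<inter> space M) = measure M A"
  using assms by (simp add: invertible_mpt_def measure_def)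

lemma invertible_mpt_AE:
  assumes "invertible_mpt M \<theta>" "AE \<omega> in M. P \<omega>"
  shows "AE \<omega> in M. P (\<theta> \<omega>)"
proof -
  have "distr M M \<theta> = M"
    using assms(1) by (intro measure_eqI) (auto simp: invertible_mpt_def emeasure_distr)
  then show ?thesis
    using AE_distrD[OF invertible_mpt_measurable[OF assms(1)]] assms(2) by metis
qed

text \<open>Ergodicity speaks of strictly invariant sets. The set of points whose orbit visits \<open>A\<close>
  infinitely often is strictly invariant, and it agrees with \<open>A\<close> almost everywhere, because almost
  every orbit lies either entirely in \<open>A\<close> or entirely outside of \<open>A\<close>.\<close>

lemma ergodic_AE_invariant:
  assumes "prob_space M" "invertible_mpt M \<theta>" "ergodic M \<theta>"
    and [measurable]: "A \<in> sets M" and inv: "AE \<omega> in M. \<theta> \<omega> \<in> A \<longleftrightarrow> \<omega> \<in> A"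
  shows "measure M A = 0 \<or> measure M A = 1"
proof -
  interpret prob_space M by fact
  have [measurable]: "\<theta> \<in> measurable M M" by (rule invertible_mpt_measurable) fact
  define R where "R = {\<omega> \<in> space M. \<forall>n. \<exists>m\<ge>n. (\<theta> ^^ m) \<omega> \<in> A}"
  have [measurable]: "R \<in> sets M" unfolding R_def by measurable
  have shift: "(\<forall>n. \<exists>m\<ge>n. (\<theta> ^^ m) (\<theta> \<omega>) \<in> A) \<longleftrightarrow> (\<forall>n. \<exists>m\<ge>n. (\<theta> ^^ m) \<omega> \<in> A)" for \<omega>
  proof safe
    fix n assume "\<forall>n. \<exists>m\<ge>n. (\<theta> ^^ m) (\<theta> \<omega>) \<in> A"
    then obtain m where "m \<ge> n" "(\<theta> ^^ m) (\<theta> \<omega>) \<in> A" by blast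
    then show "\<exists>m\<ge>n. (\<theta> ^^ m) \<omega> \<in> A"
      by (intro exI[of _ "Suc m"]) (auto simp: funpow_swap1)
  next
    fix n assume "\<forall>n. \<exists>m\<ge>n. (\<theta> ^^ m) \<omega> \<in> A"
    then obtain m where "m \<ge> Suc n" "(\<theta> ^^ m) \<omega> \<in> A" by blast
    then show "\<exists>m\<ge>n. (\<theta> ^^ m) (\<theta> \<omega>) \<in> A"
      by (intro exI[of _ "m - 1"]) (cases m; auto simp: funpow_swap1)
  qed
  have "\<theta> -` R \<inter> space M = R"
    using measurable_space[OF \<open>\<theta> \<in> measurable M M\<close>] by (auto simp: R_def shift)
  then have R01: "measure M R = 0 \<or> measure M R = 1"
    using \<open>ergodic M \<theta>\<close> by (auto simp: ergodic_def emeasure_eq_measure)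
  have step: "AE \<omega> in M. (\<theta> ^^ n) \<omega> \<in> A \<longleftrightarrow> \<omega> \<in> A" for n
  proof (induction n)
    case (Suc n)
    have "AE \<omega> in M. (\<theta> ^^ n) (\<theta> \<omega>) \<in> A \<longleftrightarrow> \<theta> \<omega> \<in> A"
      by (rule invertible_mpt_AE[OF assms(2) Suc])
    then show ?case using inv by eventually_elim (simp add: funpow_swap1)
  qed auto
  have "AE \<omega> in M. \<forall>n. (\<theta> ^^ n) \<omega> \<in> A \<longleftrightarrow> \<omega> \<in> A"
    using step by (simp add: AE_all_countable)
  then have "AE \<omega> in M. \<omega> \<in> R \<longleftrightarrow> \<omega> \<in> A"
    using AE_space by eventually_elim (auto simp: R_def)
  then have "measure M R = measure M A" by (intro finite_measure_eq_AE) auto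
  with R01 show ?thesis by simp
qed

definition hits_within :: "'a measure \<Rightarrow> ('a \<Rightarrow> 'a) \<Rightarrow> 'a set \<Rightarrow> nat \<Rightarrow> 'a set" where
  "hits_within M \<theta> B k = {\<omega> \<in> space M. \<exists>j\<le>k. (\<theta> ^^ j) \<omega> \<in> B}"

lemma sets_hits_within:
  assumes [measurable]: "\<theta> \<in> measurable M M" "B \<in> sets M"
  shows "hits_within M \<theta> B k \<in> sets M"
  unfolding hits_within_def by measurable

lemma hits_within_mono: "j \<le> k \<Longrightarrow> hits_within M \<theta> B j \<subseteq> hits_within M \<theta> B k"
  by (auto simp: hits_within_def intro: order_trans)

lemma hits_within_Suc:
  assumes "\<theta> \<in> measurable M M" "B \<in> sets M"
  shows "hits_within M \<theta> B (Suc k) = B \<union> (\<theta> -` hits_within M \<theta> B k \<inter> space M)"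
proof (rule set_eqI)
  fix \<omega>
  have "(\<exists>j\<le>Suc k. (\<theta> ^^ j) \<omega> \<in> B) \<longleftrightarrow> \<omega> \<in> B \<or> (\<exists>j\<le>k. (\<theta> ^^ j) (\<theta> \<omega>) \<in> B)"
    by (simp add: less_Suc_eq_le [symmetric] Ex_less_Suc2 funpow_swap1)
  then show "\<omega> \<in> hits_within M \<theta> B (Suc k) \<longleftrightarrow>
      \<omega> \<in> B \<union> (\<theta> -` hits_within M \<theta> B k \<inter> space M)"
    using sets.sets_into_space[OF assms(2)] measurable_space[OF assms(1)]
    by (auto simp: hits_within_def)
qed

lemma measure_hits_within_Suc_le:
  assumes "prob_space M" "invertible_mpt M \<theta>" "B \<in> sets M"
  shows "measure M (hits_within M \<theta> B (Suc k)) \<le> measure M B + measure M (hits_within M \<theta> B k)"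
proof -
  interpret prob_space M by fact
  have \<theta>[measurable]: "\<theta> \<in> measurable M M" by (rule invertible_mpt_measurable) fact
  have [measurable]: "hits_within M \<theta> B k \<in> sets M" "B \<in> sets M"
    using assms(3) by (auto intro: sets_hits_within)
  show ?thesis
    unfolding hits_within_Suc[OF \<theta> assms(3)]
    using measure_Un_le[of B M "\<theta> -` hits_within M \<theta> B k \<inter> space M"]
    by (simp add: invertible_mpt_measure[OF assms(2)])
qed

text \<open>The union of the hitting sets contains its own preimage. The two have the same finite
  measure, so they differ by a null set and ergodicity applies.\<close>

lemma measure_hits_within_tendsto_1:
  assumes "prob_space M" "invertible_mpt M \<theta>" "ergodic M \<theta>" "B \<in> sets M" "0 < measure M B"
  shows "(\<lambda>k. measure M (hits_within M \<theta> B k)) \<longlonglongrightarrow> 1"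
proof -
  interpret prob_space M by fact
  have \<theta>[measurable]: "\<theta> \<in> measurable M M" by (rule invertible_mpt_measurable) fact
  have H[measurable]: "hits_within M \<theta> B k \<in> sets M" for k
    using assms(4) by (auto intro: sets_hits_within)
  define U where "U = (\<Union>k. hits_within M \<theta> B k)"
  have [measurable]: "U \<in> sets M" unfolding U_def by measurable
  have sub: "\<theta> -` U \<inter> space M \<subseteq> U"
    using hits_within_Suc[OF \<theta> assms(4)] by (force simp: U_def)
  have "measure M (U - (\<theta> -` U \<inter> space M)) = 0"
    using sub by (subst finite_measure_Diff) (auto simp: invertible_mpt_measure[OF assms(2)])
  then have "AE \<omega> in M. \<omega> \<notin> U - (\<theta> -` U \<inter> space M)"
    by (intro AE_not_in) (auto simp: null_sets_def emeasure_eq_measure)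
  then have "AE \<omega> in M. \<theta> \<omega> \<in> U \<longleftrightarrow> \<omega> \<in> U"
    using AE_space by eventually_elim (use sub in auto)
  then have "measure M U = 0 \<or> measure M U = 1"
    by (intro ergodic_AE_invariant[OF assms(1-3)]) auto
  moreover have "B \<subseteq> U"
    using sets.sets_into_space[OF assms(4)] by (force simp: U_def hits_within_def)
  then have "measure M B \<le> measure M U" by (intro finite_measure_mono) auto
  ultimately have "measure M U = 1" using assms(5) by linarith
  moreover have "incseq (hits_within M \<theta> B)"
    by (auto simp: incseq_def hits_within_mono)
  ultimately show ?thesis
    using finite_Lim_measure_incseq[of "hits_within M \<theta> B"] H by (simp add: U_def image_subset_iff)
qed

definition switch_set :: "'a measure \<Rightarrow> ('a \<Rightarrow> 'a) \<Rightarrow> 'a set \<Rightarrow> 'a set" where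
  "switch_set M \<theta> A = {\<omega> \<in> space M. \<not> (\<theta> \<omega> \<in> A \<longleftrightarrow> \<omega> \<in> A)}"

lemma sets_switch_set:
  assumes [measurable]: "\<theta> \<in> measurable M M" "A \<in> sets M"
  shows "switch_set M \<theta> A \<in> sets M"
  unfolding switch_set_def by measurable

text \<open>Writing \<open>A\<^sub>k\<close> for the hitting sets, \<open>A\<^bsub>k+1\<^esub> = B \<union> \<theta>\<^sup>-\<^sup>1 A\<^sub>k\<close> shows that the points leaving
  \<open>A\<^sub>k\<close> lie in \<open>B\<close> and that those entering it lie in \<open>A\<^bsub>k+1\<^esub> - A\<^sub>k\<close>. Both sets have measure at most
  that of \<open>B\<close>.\<close>

lemma measure_switch_set_hits_within:
  assumes "prob_space M" "invertible_mpt M \<theta>" "B \<in> sets M"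
  shows "measure M (switch_set M \<theta> (hits_within M \<theta> B k)) \<le> 2 * measure M B"
proof -
  interpret prob_space M by fact
  have \<theta>: "\<theta> \<in> measurable M M" by (rule invertible_mpt_measurable) fact
  let ?H = "hits_within M \<theta> B"
  have H[measurable]: "?H k \<in> sets M" for k
    by (rule sets_hits_within[OF \<theta> assms(3)])
  have "switch_set M \<theta> (?H k) \<subseteq> B \<union> (?H (Suc k) - ?H k)"
    using hits_within_Suc[OF \<theta> assms(3), of k] hits_within_mono[of k "Suc k" M \<theta> B]
    by (auto simp: switch_set_def)
  then have "measure M (switch_set M \<theta> (?H k)) \<le> measure M (B \<union> (?H (Suc k) - ?H k))"
    using assms(3) by (intro finite_measure_mono) auto
  also have "\<dots> \<le> measure M B + measure M (?H (Suc k) - ?H k)"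
    using assms(3) by (intro measure_Un_le) auto
  also have "measure M (?H (Suc k) - ?H k) = measure M (?H (Suc k)) - measure M (?H k)"
    by (intro finite_measure_Diff H hits_within_mono) auto
  finally show ?thesis using measure_hits_within_Suc_le[OF assms, of k] by linarith
qed

lemma almost_invariant_half_set:
  assumes "prob_space M" "nonatomic M" "invertible_mpt M \<theta>" "ergodic M \<theta>" "0 < e"
  obtains A where "A \<in> sets M" "1/2 \<le> measure M A" "measure M A \<le> 3/4"
    "measure M (switch_set M \<theta> A) \<le> e"
proof -
  interpret prob_space M by fact
  have \<theta>: "\<theta> \<in> measurable M M" by (rule invertible_mpt_measurable) fact
  \<comment> \<open>The bound \<open>1/4\<close> limits the overshoot above \<open>1/2\<close>; the factor \<open>2\<close> is that of the switch set.\<close>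
  obtain B where B: "B \<in> sets M" "0 < measure M B" "measure M B < min (1/4) (e/2)"
    using nonatomic_small_set[OF assms(1,2), of "min (1/4) (e/2)"] \<open>0 < e\<close> by auto
  let ?H = "hits_within M \<theta> B"
  have "eventually (\<lambda>k. 1/2 < measure M (?H k)) sequentially"
    by (rule order_tendstoD(1)[OF measure_hits_within_tendsto_1[OF assms(1,3,4) B(1,2)]]) simp
  then have ex: "\<exists>k. 1/2 \<le> measure M (?H k)"
    by (meson eventually_sequentially order.refl order.strict_implies_order)
  define k where "k = (LEAST k. 1/2 \<le> measure M (?H k))"
  have k: "1/2 \<le> measure M (?H k)" using LeastI_ex[OF ex] by (simp add: k_def)
  have "measure M (?H k) \<le> 3/4"
  proof (cases k)
    case 0
    have "?H 0 = B" using sets.sets_into_space[OF B(1)] by (auto simp: hits_within_def)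
    then show ?thesis using B 0 by simp
  next
    case (Suc j)
    have "measure M (?H j) < 1/2"
      using not_less_Least[of j "\<lambda>k. 1/2 \<le> measure M (?H k)"] Suc
      unfolding k_def[symmetric] by simp
    then show ?thesis
      using measure_hits_within_Suc_le[OF assms(1,3) B(1), of j] B(3) unfolding Suc by simp
  qed
  moreover have "measure M (switch_set M \<theta> (?H k)) \<le> e"
    using measure_switch_set_hits_within[OF assms(1,3) B(1), of k] B by simp
  ultimately show ?thesis using that[of "?H k"] k sets_hits_within[OF \<theta> B(1)] by blast
qed

section \<open>Limits of almost invariant sets\<close>

lemma measure_tendsto_of_AE_eventually_eq:
  assumes "prob_space M" and [measurable]: "\<And>n. A n \<in> sets M" "C \<in> sets M"
    and ev: "AE \<omega> in M. \<forall>\<^sub>F n in sequentially. \<omega> \<in> A n \<longleftrightarrow> \<omega> \<in> C"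
  shows "(\<lambda>n. measure M (A n)) \<longlonglongrightarrow> measure M C"
proof -
  interpret prob_space M by fact
  have "(\<lambda>n. integral\<^sup>L M (indicator (A n) :: 'a \<Rightarrow> real)) \<longlonglongrightarrow> integral\<^sup>L M (indicator C)"
  proof (rule integral_dominated_convergence[where w = "\<lambda>_. 1"])
    show "AE \<omega> in M. (\<lambda>n. indicator (A n) \<omega> :: real) \<longlonglongrightarrow> indicator C \<omega>"
      using ev by eventually_elim
        (auto intro!: tendsto_eventually simp: indicator_def elim: eventually_mono)
  qed (auto simp: indicator_def)
  then show ?thesis by simp
qed

text \<open>A limit of almost invariant sets is invariant modulo null sets, so by ergodicity it has
  measure \<open>0\<close> or \<open>1\<close>. This is the step that forbids convergence.\<close>

lemma ergodic_limit_of_almost_invariant: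
  assumes "prob_space M" "invertible_mpt M \<theta>" "ergodic M \<theta>"
    and A: "\<And>n. A n \<in> sets M" and C: "C \<in> sets M"
    and ev: "AE \<omega> in M. \<forall>\<^sub>F n in sequentially. \<omega> \<in> A n \<longleftrightarrow> \<omega> \<in> C"
    and S: "(\<lambda>n. measure M (switch_set M \<theta> (A n))) \<longlonglongrightarrow> 0"
  shows "(\<lambda>n. measure M (A n)) \<longlonglongrightarrow> 0 \<or> (\<lambda>n. measure M (A n)) \<longlonglongrightarrow> 1"
proof -
  interpret prob_space M by fact
  have \<theta>: "\<theta> \<in> measurable M M" by (rule invertible_mpt_measurable) fact
  have "AE \<omega> in M. \<forall>\<^sub>F n in sequentially. \<omega> \<in> switch_set M \<theta> (A n) \<longleftrightarrow> \<omega> \<in> switch_set M \<theta> C"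
    using ev invertible_mpt_AE[OF assms(2) ev]
  proof eventually_elim
    case (elim \<omega>)
    then show ?case by eventually_elim (simp add: switch_set_def)
  qed
  then have "(\<lambda>n. measure M (switch_set M \<theta> (A n))) \<longlonglongrightarrow> measure M (switch_set M \<theta> C)"
    by (intro measure_tendsto_of_AE_eventually_eq assms(1) sets_switch_set \<theta> A C)
  then have "measure M (switch_set M \<theta> C) = 0" using S LIMSEQ_unique by blast
  then have "AE \<omega> in M. \<omega> \<notin> switch_set M \<theta> C"
    using sets_switch_set[OF \<theta> C] by (intro AE_not_in) (auto simp: null_sets_def emeasure_eq_measure)
  then have "AE \<omega> in M. \<theta> \<omega> \<in> C \<longleftrightarrow> \<omega> \<in> C"
    using AE_space by eventually_elim (auto simp: switch_set_def)
  then have "measure M C = 0 \<or> measure M C = 1"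
    by (rule ergodic_AE_invariant[OF assms(1-3) C])
  then show ?thesis
    using measure_tendsto_of_AE_eventually_eq[OF assms(1) A C ev] by auto
qed

section \<open>Convergence in the Lebesgue spaces\<close>

lemma Lp_norm_tendsto_0:
  assumes "0 < p"
    and I: "(\<lambda>n. \<integral>\<^sup>+\<omega>. ennreal (norm (f n \<omega>) powr p) \<partial>M) \<longlonglongrightarrow> 0"
  shows "(\<lambda>n. Lp_norm M p (f n)) \<longlonglongrightarrow> 0"
proof -
  let ?I = "\<lambda>n. \<integral>\<^sup>+\<omega>. ennreal (norm (f n \<omega>) powr p) \<partial>M"
  have "(\<lambda>n. enn2real (?I n)) \<longlonglongrightarrow> 0" using tendsto_enn2real[of ?I 0] I by simp
  then have "(\<lambda>n. enn2real (?I n) powr (1/p)) \<longlonglongrightarrow> 0"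
    using \<open>0 < p\<close> by (intro tendsto_zero_powrI[OF _ tendsto_const]) auto
  then have "(\<lambda>n. ennreal (enn2real (?I n) powr (1/p))) \<longlonglongrightarrow> 0"
    using tendsto_ennrealI by fastforce
  moreover have "eventually (\<lambda>n. ?I n < \<infinity>) sequentially"
    using order_tendstoD(2)[OF I, of \<infinity>] by simp
  then have "eventually (\<lambda>n. ennreal (enn2real (?I n) powr (1/p)) = Lp_norm M p (f n)) sequentially"
    by eventually_elim (auto simp: Lp_norm_def Let_def)
  ultimately show ?thesis by (rule Lim_transform_eventually)
qed

lemma Lp_norm_tendsto_0D:
  assumes "0 < p" and L: "(\<lambda>n. Lp_norm M p (f n)) \<longlonglongrightarrow> 0"
  shows "(\<lambda>n. \<integral>\<^sup>+\<omega>. ennreal (norm (f n \<omega>) powr p) \<partial>M) \<longlonglongrightarrow> 0"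
proof -
  let ?I = "\<lambda>n. \<integral>\<^sup>+\<omega>. ennreal (norm (f n \<omega>) powr p) \<partial>M"
  have "(\<lambda>n. enn2real (Lp_norm M p (f n))) \<longlonglongrightarrow> 0"
    using tendsto_enn2real[of "\<lambda>n. Lp_norm M p (f n)" 0] L by simp
  then have "(\<lambda>n. enn2real (Lp_norm M p (f n)) powr p) \<longlonglongrightarrow> 0"
    using \<open>0 < p\<close> by (intro tendsto_zero_powrI[OF _ tendsto_const]) auto
  then have "(\<lambda>n. ennreal (enn2real (Lp_norm M p (f n)) powr p)) \<longlonglongrightarrow> 0"
    using tendsto_ennrealI by fastforce
  moreover have "eventually (\<lambda>n. Lp_norm M p (f n) < \<infinity>) sequentially"
    using order_tendstoD(2)[OF L, of \<infinity>] by simp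
  then have "eventually (\<lambda>n. ennreal (enn2real (Lp_norm M p (f n)) powr p) = ?I n) sequentially"
  proof eventually_elim
    case (elim n)
    then have "?I n \<noteq> \<infinity>" by (auto simp: Lp_norm_def Let_def)
    then show ?case
      using \<open>0 < p\<close> by (simp add: Lp_norm_def Let_def powr_powr ennreal_enn2real_if)
  qed
  ultimately show ?thesis by (rule Lim_transform_eventually)
qed

lemma Lp_converges_AE_subseq:
  fixes u :: "nat \<Rightarrow> 'a \<Rightarrow> 'x::polish_space"
  assumes "0 < p" and [measurable]: "\<And>n. u n \<in> borel_measurable M"
    and "Lp_converges M p x\<^sub>0 u"
  obtains v r where "v \<in> borel_measurable M" "strict_mono r"
    "AE \<omega> in M. (\<lambda>n. u (r n) \<omega>) \<longlonglongrightarrow> v \<omega>"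
proof -
  obtain v where v: "v \<in> Lp_space M p x\<^sub>0" and "(\<lambda>n. Lp_dist M p (u n) v) \<longlonglongrightarrow> 0"
    using assms(3) by (auto simp: Lp_converges_def)
  then have I: "(\<lambda>n. \<integral>\<^sup>+\<omega>. ennreal (dist (u n \<omega>) (v \<omega>) powr p) \<partial>M) \<longlonglongrightarrow> 0"
    using Lp_norm_tendsto_0D[OF \<open>0 < p\<close>, of M "\<lambda>n \<omega>. dist (u n \<omega>) (v \<omega>)"]
    by (simp add: Lp_dist_def)
  have [measurable]: "v \<in> borel_measurable M"
    using v by (auto simp: Lp_space_def intro: strongly_measurable_borel)
  define w where "w n \<omega> = dist (u n \<omega>) (v \<omega>) powr p" for n \<omega>
  have w[measurable]: "w n \<in> borel_measurable M" for n unfolding w_def by measurable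
  have "eventually (\<lambda>n. (\<integral>\<^sup>+\<omega>. ennreal (w n \<omega>) \<partial>M) < \<infinity>) sequentially"
    using order_tendstoD(2)[OF I, of \<infinity>] by (simp add: w_def)
  then obtain N where N: "\<And>n. n \<ge> N \<Longrightarrow> (\<integral>\<^sup>+\<omega>. ennreal (w n \<omega>) \<partial>M) < \<infinity>"
    by (auto simp: eventually_sequentially)
  \<comment> \<open>Only from \<open>N\<close> on are the integrals known to be finite, so the sequence is shifted by \<open>N\<close>.\<close>
  have int: "integrable M (w (n + N))" for n
    using N[of "n + N"] by (intro integrableI_nonneg) (auto simp: w_def)
  have "(\<lambda>n. enn2real (\<integral>\<^sup>+\<omega>. ennreal (w n \<omega>) \<partial>M)) \<longlonglongrightarrow> 0"
    using tendsto_enn2real[of "\<lambda>n. \<integral>\<^sup>+\<omega>. ennreal (w n \<omega>) \<partial>M" 0] I by (simp add: w_def)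
  then have "(\<lambda>n. \<integral>\<omega>. norm (w (n + N) \<omega>) \<partial>M) \<longlonglongrightarrow> 0"
    by (subst integral_eq_nn_integral) (auto simp: w_def dest: LIMSEQ_ignore_initial_segment[of _ _ N])
  from tendsto_L1_AE_subseq[OF int this] obtain r :: "nat \<Rightarrow> nat"
    where r: "strict_mono r" and lim: "AE \<omega> in M. (\<lambda>n. w (r n + N) \<omega>) \<longlonglongrightarrow> 0"
    by blast
  have "AE \<omega> in M. (\<lambda>n. u (r n + N) \<omega>) \<longlonglongrightarrow> v \<omega>"
    using lim
  proof eventually_elim
    case (elim \<omega>)
    have "(\<lambda>n. w (r n + N) \<omega> powr (1/p)) \<longlonglongrightarrow> 0"
      using elim \<open>0 < p\<close> by (intro tendsto_zero_powrI[OF _ tendsto_const]) (auto simp: w_def)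
    then show ?case
      using \<open>0 < p\<close> by (simp add: w_def powr_powr tendsto_dist_iff[symmetric])
  qed
  moreover have "strict_mono (\<lambda>n. r n + N)" using r by (simp add: strict_mono_def)
  ultimately show ?thesis using that \<open>v \<in> borel_measurable M\<close> by blast
qed

text \<open>At a point where the two selections differ, a convergent sequence of values taken from
  these two points is eventually constant.\<close>

lemma switched_tendsto_eventually:
  assumes "(\<lambda>n. switched \<xi> (A n) \<omega>) \<longlonglongrightarrow> v" "\<xi> 0 \<omega> \<noteq> (\<xi> 1 \<omega> :: 'x::metric_space)"
  shows "\<forall>\<^sub>F n in sequentially. \<omega> \<in> A n \<longleftrightarrow> v = \<xi> 1 \<omega>"
proof (cases "v = \<xi> 1 \<omega>")
  case True
  then have "\<forall>\<^sub>F n in sequentially. switched \<xi> (A n) \<omega> \<noteq> \<xi> 0 \<omega>"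
    using assms by (intro tendsto_imp_eventually_ne[OF assms(1)]) auto
  then show ?thesis by (rule eventually_mono) (use True in \<open>auto simp: switched_def split: if_splits\<close>)
next
  case False
  then have "\<forall>\<^sub>F n in sequentially. switched \<xi> (A n) \<omega> \<noteq> \<xi> 1 \<omega>"
    by (intro tendsto_imp_eventually_ne[OF assms(1)])
  then show ?thesis by (rule eventually_mono) (use False in \<open>auto simp: switched_def split: if_splits\<close>)
qed

section \<open>Residuals of switched selections\<close>

lemma residual_switched_le:
  assumes "residual \<theta> G (\<xi> 0) \<omega> = 0" "residual \<theta> G (\<xi> 1) \<omega> = 0" "\<omega> \<in> space M"
  shows "norm (residual \<theta> G (switched \<xi> A) \<omega>)
    \<le> Max (cross_values \<theta> G \<xi> \<omega>) * indicator (switch_set M \<theta> A) \<omega>"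
  using assms by (auto simp: residual_def switched_def cross_values_eq switch_set_def indicator_def)

text \<open>Summable measures put almost every point in only finitely many of the sets, so dominated
  convergence applies to the truncated integrands.\<close>

lemma nn_integral_indicator_tendsto_0:
  assumes "prob_space M" and [measurable]: "f \<in> borel_measurable M" "\<And>n. S n \<in> sets M"
    and f: "(\<integral>\<^sup>+\<omega>. f \<omega> \<partial>M) < \<infinity>" and S: "summable (\<lambda>n. measure M (S n))"
  shows "(\<lambda>n. \<integral>\<^sup>+\<omega>. f \<omega> * indicator (S n) \<omega> \<partial>M) \<longlonglongrightarrow> 0"
proof -
  interpret prob_space M by fact
  have "AE \<omega> in M. \<forall>\<^sub>F n in sequentially. \<omega> \<in> space M - S n"
    using S by (intro borel_cantelli_AE1) (auto simp: emeasure_eq_measure)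
  then have "AE \<omega> in M. (\<lambda>n. f \<omega> * indicator (S n) \<omega>) \<longlonglongrightarrow> 0"
    by eventually_elim (auto intro!: tendsto_eventually elim: eventually_mono)
  then have "(\<lambda>n. \<integral>\<^sup>+\<omega>. f \<omega> * indicator (S n) \<omega> \<partial>M) \<longlonglongrightarrow> (\<integral>\<^sup>+\<omega>. 0 \<partial>M)"
    using f by (intro nn_integral_dominated_convergence[where w = f])
      (auto simp: indicator_def)
  then show ?thesis by simp
qed

lemma Lp_norm_residual_switched_tendsto_0:
  fixes G :: "'a \<Rightarrow> 'x \<Rightarrow> 'x \<Rightarrow> 'y::real_normed_vector"
  assumes "prob_space M" "\<theta> \<in> measurable M M" "0 < p"
    and res: "AE \<omega> in M. residual \<theta> G (\<xi> 0) \<omega> = 0" "AE \<omega> in M. residual \<theta> G (\<xi> 1) \<omega> = 0"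
    and q: "(\<lambda>\<omega>. Max (cross_values \<theta> G \<xi> \<omega>)) \<in> Lp_space M p 0"
    and A: "\<And>n. A n \<in> sets M" and S: "summable (\<lambda>n. measure M (switch_set M \<theta> (A n)))"
  shows "(\<lambda>n. Lp_norm M p (residual \<theta> G (switched \<xi> (A n)))) \<longlonglongrightarrow> 0"
proof (rule Lp_norm_tendsto_0[OF \<open>0 < p\<close>])
  let ?q = "\<lambda>\<omega>. Max (cross_values \<theta> G \<xi> \<omega>)"
  have q0: "0 \<le> ?q \<omega>" for \<omega> by (simp add: cross_values_eq le_max_iff_disj)
  have [measurable]: "?q \<in> borel_measurable M"
    using q by (auto simp: Lp_space_def intro: strongly_measurable_borel)
  have fin: "(\<integral>\<^sup>+\<omega>. ennreal (?q \<omega> powr p) \<partial>M) < \<infinity>"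
    using q q0 by (simp add: Lp_space_def)
  have up: "(\<lambda>n. \<integral>\<^sup>+\<omega>. ennreal (?q \<omega> powr p) * indicator (switch_set M \<theta> (A n)) \<omega> \<partial>M) \<longlonglongrightarrow> 0"
    by (rule nn_integral_indicator_tendsto_0[OF assms(1) _ _ fin S])
      (auto intro!: sets_switch_set assms(2) A)
  have le: "(\<integral>\<^sup>+\<omega>. ennreal (norm (residual \<theta> G (switched \<xi> (A n)) \<omega>) powr p) \<partial>M)
    \<le> (\<integral>\<^sup>+\<omega>. ennreal (?q \<omega> powr p) * indicator (switch_set M \<theta> (A n)) \<omega> \<partial>M)" for n
  proof (rule nn_integral_mono_AE)
    show "AE \<omega> in M. ennreal (norm (residual \<theta> G (switched \<xi> (A n)) \<omega>) powr p)
      \<le> ennreal (?q \<omega> powr p) * indicator (switch_set M \<theta> (A n)) \<omega>"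
      using res AE_space
    proof eventually_elim
      case (elim \<omega>)
      from residual_switched_le[OF elim, of "A n"] show ?case
        using \<open>0 < p\<close> by (cases "\<omega> \<in> switch_set M \<theta> (A n)") (auto intro!: ennreal_leI powr_mono2)
    qed
  qed
  show "(\<lambda>n. \<integral>\<^sup>+\<omega>. ennreal (norm (residual \<theta> G (switched \<xi> (A n)) \<omega>) powr p) \<partial>M) \<longlonglongrightarrow> 0"
    by (rule tendsto_sandwich[OF _ _ tendsto_const up]) (use le in auto)
qed

theorem corollary8p5:
  fixes M :: "'a measure"
    and \<theta> :: "'a \<Rightarrow> 'a"
    and p :: real
    and x\<^sub>0 :: "'x::polish_space"
    and G :: "'a \<Rightarrow> 'x \<Rightarrow> 'x \<Rightarrow> 'y::banach"
    and \<xi> :: "nat \<Rightarrow> 'a \<Rightarrow> 'x"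
  assumes "standard_prob_space M" and "nonatomic M"
    and "invertible_mpt M \<theta>" and "ergodic M \<theta>" and "aperiodic M \<theta>"
    and "1 \<le> p"
    and "measurable_family M G"
    and "\<xi> 0 \<in> Lp_space M p x\<^sub>0" and "\<xi> 1 \<in> Lp_space M p x\<^sub>0"
    and "AE \<omega> in M. residual \<theta> G (\<xi> 0) \<omega> = 0"
    and "AE \<omega> in M. residual \<theta> G (\<xi> 1) \<omega> = 0"
    and "AE \<omega> in M. 0 < dist (\<xi> 0 \<omega>) (\<xi> 1 \<omega>)"
    and "(\<lambda>\<omega>. Max (cross_values \<theta> G \<xi> \<omega>)) \<in> Lp_space M p 0"
    and "AE \<omega> in M. 0 < Min (cross_values \<theta> G \<xi> \<omega>)"
  shows "\<exists>A :: nat \<Rightarrow> 'a set.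
      (\<forall>n. A n \<in> sets M) \<and>
      (\<lambda>n. Lp_norm M p (residual \<theta> G (switched \<xi> (A n)))) \<longlonglongrightarrow> 0 \<and>
      \<not> (\<exists>k :: nat \<Rightarrow> nat. strict_mono k \<and> Lp_converges M p x\<^sub>0 (\<lambda>n. switched \<xi> (A (k n))))"
proof -
  interpret prob_space M using assms(1) by (simp add: standard_prob_space_def)
  have M: "prob_space M" by unfold_locales
  have \<theta>: "\<theta> \<in> measurable M M" by (rule invertible_mpt_measurable) fact
  have p: "0 < p" using \<open>1 \<le> p\<close> by simp
  \<comment> \<open>A summable error, so that almost every point switches for only finitely many \<open>n\<close>.\<close>
  have "\<exists>A. A \<in> sets M \<and> 1/2 \<le> measure M A \<and> measure M A \<le> 3/4 \<and>
      measure M (switch_set M \<theta> A) \<le> (1/2) ^ n" for n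
    by (rule almost_invariant_half_set[OF M assms(2-4), of "(1/2) ^ n"]) auto
  then obtain A where A: "\<And>n. A n \<in> sets M"
    and low: "\<And>n. 1/2 \<le> measure M (A n)" and high: "\<And>n. measure M (A n) \<le> 3/4"
    and sw: "\<And>n::nat. measure M (switch_set M \<theta> (A n)) \<le> (1/2) ^ n"
    by metis
  have S: "summable (\<lambda>n. measure M (switch_set M \<theta> (A n)))"
    by (rule summable_comparison_test'[OF summable_geometric[of "1/2::real"], of 0])
      (use sw in auto)
  have "(\<lambda>n. Lp_norm M p (residual \<theta> G (switched \<xi> (A n)))) \<longlonglongrightarrow> 0"
    by (rule Lp_norm_residual_switched_tendsto_0[OF M \<theta> p assms(10,11,13) A S])
  moreover have False if k: "strict_mono k" and conv: "Lp_converges M p x\<^sub>0 (\<lambda>n. switched \<xi> (A (k n)))"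
    for k :: "nat \<Rightarrow> nat"
  proof -
    have [measurable]: "switched \<xi> (A n) \<in> borel_measurable M" "\<xi> 1 \<in> borel_measurable M" for n
      using switched_in_Lp_space[OF assms(8,9) A, of n] assms(9)
      by (auto simp: Lp_space_def intro: strongly_measurable_borel)
    obtain v r where [measurable]: "v \<in> borel_measurable M" and r: "strict_mono r"
      and lim: "AE \<omega> in M. (\<lambda>n. switched \<xi> (A (k (r n))) \<omega>) \<longlonglongrightarrow> v \<omega>"
      by (rule Lp_converges_AE_subseq[OF p _ conv]) auto
    define C where "C = {\<omega> \<in> space M. v \<omega> = \<xi> 1 \<omega>}"
    have C: "C \<in> sets M" unfolding C_def by measurable
    have ev: "AE \<omega> in M. \<forall>\<^sub>F n in sequentially. \<omega> \<in> A (k (r n)) \<longleftrightarrow> \<omega> \<in> C"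
      using lim assms(12) AE_space
    proof eventually_elim
      case (elim \<omega>)
      then show ?case
        using switched_tendsto_eventually[of \<xi> "\<lambda>n. A (k (r n))" \<omega>] by (simp add: C_def)
    qed
    have "(\<lambda>n. measure M (switch_set M \<theta> (A (k (r n))))) \<longlonglongrightarrow> 0"
      using LIMSEQ_subseq_LIMSEQ[OF summable_LIMSEQ_zero[OF S] strict_mono_o[OF k r]]
      by (simp add: o_def)
    from ergodic_limit_of_almost_invariant[OF M assms(3,4) A C ev this]
    consider "(\<lambda>n. measure M (A (k (r n)))) \<longlonglongrightarrow> 0" | "(\<lambda>n. measure M (A (k (r n)))) \<longlonglongrightarrow> 1"
      by blast
    then show False
    proof cases
      case 1
      then have "1/2 \<le> (0::real)" by (rule LIMSEQ_le_const) (use low in auto)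
      then show False by simp
    next
      case 2
      then have "1 \<le> (3/4::real)" by (rule LIMSEQ_le_const2) (use high in auto)
      then show False by simp
    qed
  qed
  ultimately show ?thesis using A by blast
qed

end
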